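(* Let $a$ and $b$ be real numbers with $a\ne b$, let $0<\tau<1$, and let $$\delta_{a,b}(t)=\frac{b-a}{e^{(b-a)t}-1}-\frac1t+b,\qquad t\in\mathbb{R}\setminus\{0\}.$$ Then the following hold. (1) The function $\delta_{a,b}(t)$ is increasing and concave on $(0,\infty)$ and convex on $(-\infty,0)$. (2) The inequality $\delta_{a,b}(\tau t)<\delta_{a,b}(t)$ is valid on $(0,\infty)$; if either $a+b\ne0$ or $ab\ne0$, then this inequality is sharp. (3) If $a+b\ge0$, then the inequality $\tau\,\delta_{a,b}(t)<\delta_{a,b}(\tau t)$ is valid on $(0,\infty)$, i.e., the function $-\delta_{a,b}(t)$ is star-shaped; if $\max\{a,b\}\le0$, then this inequality is reversed, i.e., the function $\delta_{a,b}(t)$ is star-shaped; if $a+b=0$, then the inequality $\tau\,\delta_{a,b}(t)<\delta_{a,b}(\tau t)$ is sharp.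
   Context: A function $f$ is said to be star-shaped on $(0,\infty)$ if $f(\sigma x)\le\sigma f(x)$ for all $x\in(0,\infty)$ and all $0<\sigma<1$. For $t\neq 0$ one also has $\delta_{a,b}(t)=\dfrac{be^{bt}-ae^{at}}{e^{bt}-e^{at}}-\dfrac1t$. *)

theory Defs
  imports "HOL-Analysis.Analysis"
begin

text \<open>At \<open>t = 0\<close> division by zero makes this a junk value; all statements below restrict \<open>t\<close> to
  \<open>(0, \<infinity>)\<close> or \<open>(-\<infinity>, 0)\<close>.\<close>

definition \<delta> :: "real \<Rightarrow> real \<Rightarrow> real \<Rightarrow> real" where
  "\<delta> a b t = (b - a) / (exp ((b - a) * t) - 1) - 1 / t + b"

lemma \<delta>_alt:
  assumes "a \<noteq> b" and "t \<noteq> 0"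
  shows "\<delta> a b t = (b * exp (b * t) - a * exp (a * t)) / (exp (b * t) - exp (a * t)) - 1 / t"
proof -
  have eq: "exp ((b - a) * t) = exp (b * t) / exp (a * t)"
    by (simp add: left_diff_distrib exp_diff)
  have "exp (b * t) \<noteq> exp (a * t)"
    using assms by simp
  then show ?thesis
    unfolding \<delta>_def eq by (simp add: field_simps)
qed

definition star_shaped :: "(real \<Rightarrow> real) \<Rightarrow> bool" where
  "star_shaped f \<longleftrightarrow> (\<forall>x>0. \<forall>\<sigma>. 0 < \<sigma> \<and> \<sigma> < 1 \<longrightarrow> f (\<sigma> * x) \<le> \<sigma> * f x)"

text \<open>An inequality \<open>f < c * g\<close> (resp. \<open>c * g < f\<close>) is called sharp on \<open>S\<close> if its constant
  factor \<open>c\<close> is best possible: no other factor \<open>k\<close> gives a valid bound that is smaller (resp. larger)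
  than the original one at any point of \<open>S\<close>. Comparing \<open>k * g\<close> with \<open>c * g\<close> rather than \<open>k\<close> with
  \<open>c\<close> is needed because \<open>g\<close> may be negative or change sign on \<open>S\<close>, so that a smaller factor need not
  give a smaller bound.\<close>

definition sharp_upper_on :: "real set \<Rightarrow> (real \<Rightarrow> real) \<Rightarrow> real \<Rightarrow> (real \<Rightarrow> real) \<Rightarrow> bool" where
  "sharp_upper_on S f c g \<longleftrightarrow>
     (\<forall>k. (\<forall>t\<in>S. f t \<le> k * g t) \<longrightarrow> (\<forall>t\<in>S. c * g t \<le> k * g t))"

definition sharp_lower_on :: "real set \<Rightarrow> (real \<Rightarrow> real) \<Rightarrow> real \<Rightarrow> (real \<Rightarrow> real) \<Rightarrow> bool" where
  "sharp_lower_on S f c g \<longleftrightarrow>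
     (\<forall>k. (\<forall>t\<in>S. k * g t \<le> f t) \<longrightarrow> (\<forall>t\<in>S. k * g t \<le> c * g t))"

end

theory Submission
  imports Defs "HOL-Real_Asymp.Real_Asymp"
begin

text \<open>
  Put \<open>m = (a + b) / 2\<close> and \<open>c = \<bar>b - a\<bar> / 2\<close>. Rewriting the exponential through the hyperbolic
  cotangent gives \<open>\<delta> a b t = m + c * L (c * t)\<close>, where \<open>L x = coth x - 1 / x\<close> is the Langevin
  function. So the two parameters only translate and rescale one fixed odd function, and everything
  follows from the shape of \<open>L\<close> on the positive half-line.

  There \<open>L\<close> increases from \<open>0\<close> to \<open>1\<close>, since \<open>L' x = 1 / x\<^sup>2 - 1 / (sinh x)\<^sup>2\<close> is positive by
  \<open>x < sinh x\<close>; and \<open>L\<close> is strictly concave, since \<open>L'' x = 2 * cosh x / sinh x ^ 3 - 2 / x ^ 3\<close> is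
  negative by the inequality \<open>x ^ 3 * cosh x < sinh x ^ 3\<close>
  (\<open>cube_mult_cosh_less_sinh_cube\<close>), the only estimate with real content. Strict concavity
  together with \<open>L 0 = 0\<close> gives \<open>\<tau> * L x < L (\<tau> * x)\<close> (\<open>scaled_langevin_less\<close>), and oddness turns
  concavity on the right into convexity on the left.

  For \<open>\<delta> a b\<close> this means that it increases on the positive half-line from \<open>m\<close> to
  \<open>m + c = max a b\<close>. When \<open>m \<ge> 0\<close>, the inequality for \<open>L\<close> and \<open>\<tau> * m \<le> m\<close> add up to
  \<open>\<tau> * \<delta> a b t < \<delta> a b (\<tau> * t)\<close>. When \<open>max a b \<le> 0\<close>, all values are negative, so multiplication
  by \<open>\<tau>\<close> enlarges them: \<open>\<delta> a b (\<tau> * t) < \<delta> a b t < \<tau> * \<delta> a b t\<close>, the reverse inequality.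

  Both sharpness claims come from limits at the ends of the half-line. If
  \<open>\<delta> a b (\<tau> * t) \<le> k * \<delta> a b t\<close> for all \<open>t > 0\<close>, then the limits at \<open>0\<close> and at infinity give
  \<open>m \<le> k * m\<close> and \<open>m + c \<le> k * (m + c)\<close>; as \<open>\<delta> a b t\<close> lies between \<open>m\<close> and \<open>m + c\<close>, also
  \<open>\<delta> a b t \<le> k * \<delta> a b t\<close>. For \<open>m = 0\<close>, a bound \<open>k * \<delta> a b t \<le> \<delta> a b (\<tau> * t)\<close> compares the slopes
  at the origin, where \<open>L x\<close> behaves like \<open>x / 3\<close>, and yields \<open>k \<le> \<tau>\<close>.
\<close>

section \<open>Reduction to the Langevin function\<close>

definition langevin :: "real \<Rightarrow> real" where
  "langevin x = cosh x / sinh x - 1 / x"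

text \<open>
  With the convention for division by zero, the removable singularity at the origin is filled with
  its limit, so that \<open>langevin\<close> is continuous there as well.
\<close>

lemma langevin_0: "langevin 0 = 0"
  by (simp add: langevin_def)

lemma langevin_minus: "langevin (- x) = - langevin x"
  by (simp add: langevin_def)

text \<open>
  Writing \<open>E = exp (d * t)\<close> with \<open>d = (b - a) / 2\<close>, one has
  \<open>2 / (E\<^sup>2 - 1) = (E\<^sup>2 + 1) / (E\<^sup>2 - 1) - 1 = coth (d * t) - 1\<close>. Since \<open>langevin\<close> is
  odd, \<open>d * langevin (d * t)\<close> is even in \<open>d\<close>; the absolute value makes the argument positive for
  \<open>t > 0\<close> whichever of \<open>a\<close> and \<open>b\<close> is larger.
\<close>

lemma \<delta>_eq_langevin:
  assumes "a \<noteq> b" and "t \<noteq> 0"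
  shows "\<delta> a b t = (a + b) / 2 + \<bar>b - a\<bar> / 2 * langevin (\<bar>b - a\<bar> / 2 * t)"
proof -
  define d where "d = (b - a) / 2"
  have d: "d \<noteq> 0" "b - a = 2 * d" "(a + b) / 2 = b - d"
    using assms by (auto simp: d_def field_simps)
  define E where "E = exp (d * t)"
  have E: "E > 0" "E \<noteq> 1" "E * E \<noteq> 1"
    using assms d by (auto simp: E_def simp flip: exp_add)
  have "\<delta> a b t = 2 * d / (E * E - 1) - 1 / t + b"
    by (simp add: \<delta>_def d E_def mult.assoc flip: exp_add)
  also have "\<dots> = (b - d) + d * ((E * E + 1) / (E * E - 1) - 1 / (d * t))"
    using E d assms by (simp add: divide_simps) (simp add: algebra_simps)
  also have "(E * E + 1) / (E * E - 1) = cosh (d * t) / sinh (d * t)"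
    using E by (simp add: cosh_field_def sinh_field_def exp_minus field_simps flip: E_def)
  finally have "\<delta> a b t = (a + b) / 2 + d * langevin (d * t)"
    by (simp add: langevin_def d)
  also have "d * langevin (d * t) = \<bar>d\<bar> * langevin (\<bar>d\<bar> * t)"
    by (simp add: abs_if langevin_minus)
  also have "\<bar>d\<bar> = \<bar>b - a\<bar> / 2"
    by (simp add: d_def)
  finally show ?thesis .
qed

section \<open>Monotonicity and concavity of the Langevin function\<close>

lemma langevin_tendsto_0: "(langevin \<longlongrightarrow> 0) (at 0)"
  unfolding langevin_def[abs_def] sinh_field_def cosh_field_def by real_asymp

lemma langevin_over_id_tendsto: "((\<lambda>x. langevin x / x) \<longlongrightarrow> 1 / 3) (at_right 0)"
  unfolding langevin_def sinh_field_def cosh_field_def by real_asymp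

lemma langevin_tendsto_1: "(langevin \<longlongrightarrow> 1) at_top"
  unfolding langevin_def[abs_def] sinh_field_def cosh_field_def by real_asymp

lemma cosh_real_gt_1:
  fixes x :: real
  assumes "0 < x"
  shows "1 < cosh x"
  using cosh_real_strict_mono[of 0 x] assms by simp

lemma less_sinh_real:
  fixes x :: real
  assumes "0 < x"
  shows "x < sinh x"
proof -
  have "sinh 0 - 0 < sinh x - x"
  proof (rule DERIV_pos_imp_increasing_open[OF assms])
    fix y :: real
    assume "0 < y" "y < x"
    then show "\<exists>d. ((\<lambda>x. sinh x - x) has_real_derivative d) (at y) \<and> 0 < d"
      by (intro exI[of _ "cosh y - 1"])
        (auto intro!: derivative_eq_intros simp: cosh_real_gt_1)
  qed (auto intro!: continuous_intros)
  then show ?thesis by simp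
qed

text \<open>
  Taking cube roots, the claim is that \<open>sinh x * cosh x powr (-1/3) - x\<close>, which vanishes at \<open>0\<close>, is
  positive. It is increasing: with \<open>q = cosh y powr (-1/3)\<close> its derivative is
  \<open>2 / (3 * q\<^sup>2) + q ^ 4 / 3 - 1\<close>, which is nonnegative by the inequality of the arithmetic and
  geometric means for \<open>1 / q\<^sup>2\<close>, \<open>1 / q\<^sup>2\<close>, \<open>q ^ 4\<close>, with equality only for \<open>q = 1\<close>. In the proof the
  resulting cubic in \<open>q\<^sup>2\<close> is factored explicitly.
\<close>

lemma cube_mult_cosh_less_sinh_cube:
  fixes x :: real
  assumes "0 < x"
  shows "x ^ 3 * cosh x < sinh x ^ 3"
proof -
  let ?f = "\<lambda>x::real. sinh x * cosh x powr (-1/3) - x"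
  have "?f 0 < ?f x"
  proof (rule DERIV_pos_imp_increasing_open[OF assms])
    fix y :: real assume y: "0 < y" "y < x"
    define q where "q = cosh y powr (-1/3)"
    have q: "0 < q" by (simp add: q_def less_le)
    have "q < 1" unfolding q_def using y cosh_real_gt_1[of y] powr_less_mono[of "-1/3" 0 "cosh y"] by simp
    then have q2: "q\<^sup>2 < 1" using q by (simp add: power_less_one_iff)
    have "q ^ 3 = cosh y powr - 1"
      unfolding q_def by (subst powr_power) auto
    then have c: "cosh y = 1 / q ^ 3"
      by (simp add: powr_minus_divide)
    have q4: "cosh y powr - (4 / 3) = q ^ 4"
      unfolding q_def by (subst powr_power) auto
    have "(?f has_real_derivative
        cosh y * q - (sinh y)\<^sup>2 * cosh y powr - (4 / 3) / 3 - 1) (at y)"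
      by (auto intro!: derivative_eq_intros simp: power2_eq_square q_def)
    then have "(?f has_real_derivative cosh y * q - (sinh y)\<^sup>2 * q ^ 4 / 3 - 1) (at y)"
      unfolding q4 .
    moreover have "0 < cosh y * q - (sinh y)\<^sup>2 * q ^ 4 / 3 - 1"
    proof -
      have "cosh y * q - (sinh y)\<^sup>2 * q ^ 4 / 3 - 1 = (1 - q\<^sup>2)\<^sup>2 * (2 + q\<^sup>2) / (3 * q\<^sup>2)"
        using q by (simp add: sinh_square_eq c field_simps) algebra
      also have "\<dots> > 0"
        using q q2 by (simp add: zero_less_mult_iff add_pos_pos)
      finally show ?thesis .
    qed
    ultimately show "\<exists>d. (?f has_real_derivative d) (at y) \<and> 0 < d" by blast
  qed (auto intro!: continuous_intros)
  then have "x ^ 3 < (sinh x * cosh x powr (-1/3)) ^ 3"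
    using assms by (intro power_strict_mono) auto
  also have "\<dots> = sinh x ^ 3 * cosh x powr - 1"
    unfolding power_mult_distrib by (subst powr_power) auto
  also have "\<dots> = sinh x ^ 3 / cosh x"
    by (simp add: powr_minus_divide)
  finally show ?thesis by (simp add: field_simps)
qed

lemma langevin_deriv:
  assumes "x \<noteq> 0"
  shows "(langevin has_real_derivative 1 / x\<^sup>2 - 1 / (sinh x)\<^sup>2) (at x)"
  unfolding langevin_def[abs_def] using assms
  by - ((rule derivative_eq_intros refl | simp)+,
    simp add: field_simps cosh_square_eq flip: power2_eq_square)

lemma langevin_deriv2:
  fixes x :: real
  assumes "x \<noteq> 0"
  shows "((\<lambda>x. 1 / x\<^sup>2 - 1 / (sinh x)\<^sup>2) has_real_derivative
           2 * cosh x / sinh x ^ 3 - 2 / x ^ 3) (at x)"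
proof -
  have "((\<lambda>x. 1 / x\<^sup>2) has_real_derivative (- 2 / x ^ 3)) (at x)"
    using assms by (auto intro!: derivative_eq_intros simp: power2_eq_square power3_eq_cube)
  moreover have "((\<lambda>x. 1 / (sinh x)\<^sup>2) has_real_derivative (- 2 * cosh x / sinh x ^ 3)) (at x)"
    using assms by (auto intro!: derivative_eq_intros simp: power2_eq_square power3_eq_cube)
  ultimately show ?thesis by (auto dest: DERIV_diff)
qed

lemma langevin_deriv_pos:
  fixes x :: real
  assumes "0 < x"
  shows "0 < 1 / x\<^sup>2 - 1 / (sinh x)\<^sup>2"
proof -
  have "x\<^sup>2 < (sinh x)\<^sup>2"
    using less_sinh_real[OF assms] assms by (intro power_strict_mono) auto
  then show ?thesis
    using assms by (simp add: divide_strict_left_mono)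
qed

lemma langevin_deriv2_neg:
  fixes x :: real
  assumes "0 < x"
  shows "2 * cosh x / sinh x ^ 3 - 2 / x ^ 3 < 0"
  using cube_mult_cosh_less_sinh_cube[OF assms] assms by (simp add: field_simps)

text \<open>
  Concavity of \<open>langevin\<close> alone would give only weak inequalities; the strict one between
  \<open>\<tau> * langevin x\<close> and \<open>langevin (\<tau> * x)\<close> rests on this strict decrease of the derivative.
\<close>

lemma langevin_deriv_antimono:
  fixes x y :: real
  assumes "0 < x" "x < y"
  shows "1 / y\<^sup>2 - 1 / (sinh y)\<^sup>2 < 1 / x\<^sup>2 - 1 / (sinh x)\<^sup>2"
proof (rule DERIV_neg_imp_decreasing[OF assms(2)])
  fix z
  assume "x \<le> z" "z \<le> y"
  then show "\<exists>d. ((\<lambda>x. 1 / x\<^sup>2 - 1 / (sinh x)\<^sup>2) has_real_derivative d) (at z) \<and> d < 0"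
    using assms langevin_deriv2[of z] langevin_deriv2_neg[of z]
    by (intro exI[of _ "2 * cosh z / sinh z ^ 3 - 2 / z ^ 3"]) auto
qed

lemma continuous_on_langevin: "continuous_on UNIV langevin"
proof -
  have "isCont langevin x" for x
  proof (cases "x = 0")
    case True
    then show ?thesis
      using langevin_tendsto_0 by (simp add: isCont_def langevin_0)
  next
    case False
    then show ?thesis
      by (rule DERIV_isCont[OF langevin_deriv])
  qed
  then show ?thesis by (simp add: continuous_at_imp_continuous_on)
qed

lemma langevin_strict_mono:
  assumes "0 \<le> x" "x < y"
  shows "langevin x < langevin y"
proof (rule DERIV_pos_imp_increasing_open[OF assms(2)])
  fix z
  assume "x < z" "z < y"
  then show "\<exists>d. (langevin has_real_derivative d) (at z) \<and> 0 < d"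
    using assms langevin_deriv[of z] langevin_deriv_pos[of z]
    by (intro exI[of _ "1 / z\<^sup>2 - 1 / (sinh z)\<^sup>2"]) auto
qed (rule continuous_on_subset[OF continuous_on_langevin subset_UNIV])

lemma langevin_pos:
  assumes "0 < x"
  shows "0 < langevin x"
  using langevin_strict_mono[of 0 x] assms by (simp add: langevin_0)

lemma langevin_less_1:
  assumes "0 < x"
  shows "langevin x < 1"
proof -
  have "langevin (x + 1) \<le> 1"
  proof (rule tendsto_lowerbound[OF langevin_tendsto_1])
    show "\<forall>\<^sub>F y in at_top. langevin (x + 1) \<le> langevin y"
      using eventually_gt_at_top[of "x + 1"]
      by eventually_elim (use assms langevin_strict_mono[of "x + 1"] in \<open>auto intro: less_imp_le\<close>)
  qed simp
  then show ?thesis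
    using langevin_strict_mono[of x "x + 1"] assms by simp
qed

lemma concave_on_langevin: "concave_on {0<..} langevin"
proof (rule f''_le0_imp_concave)
  fix x :: real
  assume "x \<in> {0<..}"
  then show "(langevin has_real_derivative 1 / x\<^sup>2 - 1 / (sinh x)\<^sup>2) (at x)"
    and "((\<lambda>x. 1 / x\<^sup>2 - 1 / (sinh x)\<^sup>2) has_real_derivative
           2 * cosh x / sinh x ^ 3 - 2 / x ^ 3) (at x)"
    and "2 * cosh x / sinh x ^ 3 - 2 / x ^ 3 \<le> 0"
    using langevin_deriv[of x] langevin_deriv2[of x] langevin_deriv2_neg[of x] by auto
qed simp

text \<open>
  The difference \<open>langevin (\<tau> * x) - \<tau> * langevin x\<close> vanishes at \<open>0\<close>, and its derivative is
  \<open>\<tau>\<close> times the difference of the derivatives of \<open>langevin\<close> at \<open>\<tau> * x\<close> and at \<open>x\<close>, hence positive.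
\<close>

lemma scaled_langevin_less:
  assumes "0 < x" "0 < \<tau>" "\<tau> < 1"
  shows "\<tau> * langevin x < langevin (\<tau> * x)"
proof -
  have "langevin (\<tau> * 0) - \<tau> * langevin 0 < langevin (\<tau> * x) - \<tau> * langevin x"
  proof (rule DERIV_pos_imp_increasing_open[OF assms(1)])
    fix z :: real
    assume z: "0 < z" "z < x"
    let ?D = "\<lambda>x::real. 1 / x\<^sup>2 - 1 / (sinh x)\<^sup>2"
    have "((\<lambda>x. langevin (\<tau> * x)) has_real_derivative ?D (\<tau> * z) * \<tau>) (at z)"
      using z assms by (intro DERIV_chain2[OF langevin_deriv]) (auto intro!: derivative_eq_intros)
    then have "((\<lambda>x. langevin (\<tau> * x) - \<tau> * langevin x) has_real_derivative
        ?D (\<tau> * z) * \<tau> - \<tau> * ?D z) (at z)"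
      using z by (intro DERIV_diff DERIV_cmult langevin_deriv) auto
    moreover have "?D z < ?D (\<tau> * z)"
      using z assms by (intro langevin_deriv_antimono) auto
    then have "0 < ?D (\<tau> * z) * \<tau> - \<tau> * ?D z"
      using assms by (simp add: mult.commute)
    ultimately show "\<exists>d. ((\<lambda>x. langevin (\<tau> * x) - \<tau> * langevin x) has_real_derivative d) (at z) \<and> 0 < d"
      by blast
  next
    show "continuous_on {0..x} (\<lambda>x. langevin (\<tau> * x) - \<tau> * langevin x)"
      by (intro continuous_intros continuous_on_compose2[OF continuous_on_langevin]) auto
  qed
  then show ?thesis by (simp add: langevin_0)
qed

section \<open>Transfer of concavity and convexity\<close>

lemma concave_on_pos_scale:
  assumes "concave_on {0<..} f" and "0 < (c::real)"
  shows "concave_on {0<..} (\<lambda>t. f (c * t))"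
  unfolding concave_on_iff
proof (intro conjI ballI allI impI)
  fix x y u v :: real
  assume *: "x \<in> {0<..}" "y \<in> {0<..}" "0 \<le> u" "0 \<le> v" "u + v = 1"
  have "u * f (c * x) + v * f (c * y) \<le> f (u * (c * x) + v * (c * y))"
    using * assms by (auto simp: concave_on_iff)
  also have "u * (c * x) + v * (c * y) = c * (u *\<^sub>R x + v *\<^sub>R y)"
    by (simp add: algebra_simps)
  finally show "u * f (c * x) + v * f (c * y) \<le> f (c * (u *\<^sub>R x + v *\<^sub>R y))" .
qed simp

lemma convex_on_neg_reflect:
  fixes f :: "real \<Rightarrow> real"
  assumes "concave_on {0<..} f"
  shows "convex_on {..<0} (\<lambda>t. - f (- t))"
  unfolding convex_on_def
proof (intro conjI ballI allI impI)
  fix x y u v :: real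
  assume *: "x \<in> {..<0}" "y \<in> {..<0}" "0 \<le> u" "0 \<le> v" "u + v = 1"
  then have "- x \<in> {0<..}" "- y \<in> {0<..}" by auto
  then have "u * f (- x) + v * f (- y) \<le> f (u *\<^sub>R (- x) + v *\<^sub>R (- y))"
    using * assms unfolding concave_on_iff by blast
  also have "u *\<^sub>R (- x) + v *\<^sub>R (- y) = - (u *\<^sub>R x + v *\<^sub>R y)"
    by simp
  finally show "- f (- (u *\<^sub>R x + v *\<^sub>R y)) \<le> u * - f (- x) + v * - f (- y)"
    by simp
qed simp

text \<open>
  Agreement is asked for on the convex set only, because the Langevin form of \<open>\<delta> a b\<close> differs from
  it at \<open>0\<close>.
\<close>

lemma convex_on_congruent:
  assumes "convex_on S f" and "\<And>x. x \<in> S \<Longrightarrow> g x = f x"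
  shows "convex_on S g"
proof -
  have "u *\<^sub>R x + v *\<^sub>R y \<in> S" if "x \<in> S" "y \<in> S" "0 \<le> u" "0 \<le> v" "u + v = 1" for x y u v
    using assms(1) that by (auto simp: convex_on_def convex_def)
  then show ?thesis
    using assms by (simp add: convex_on_def)
qed

section \<open>Monotonicity, star-shapedness and sharpness\<close>

theorem theorem2:
  fixes a b \<tau> :: real
  assumes "a \<noteq> b" and "0 < \<tau>" and "\<tau> < 1"
  shows "(strict_mono_on {0<..} (\<delta> a b) \<and> concave_on {0<..} (\<delta> a b) \<and> convex_on {..<0} (\<delta> a b))
    \<and> ((\<forall>t>0. \<delta> a b (\<tau> * t) < \<delta> a b t)
       \<and> (a + b \<noteq> 0 \<or> a * b \<noteq> 0 \<longrightarrow>
            sharp_upper_on {0<..} (\<lambda>t. \<delta> a b (\<tau> * t)) 1 (\<delta> a b)))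
    \<and> ((a + b \<ge> 0 \<longrightarrow>
            (\<forall>t>0. \<tau> * \<delta> a b t < \<delta> a b (\<tau> * t)) \<and> star_shaped (\<lambda>t. - \<delta> a b t))
       \<and> (max a b \<le> 0 \<longrightarrow>
            (\<forall>t>0. \<delta> a b (\<tau> * t) < \<tau> * \<delta> a b t) \<and> star_shaped (\<delta> a b))
       \<and> (a + b = 0 \<longrightarrow>
            sharp_lower_on {0<..} (\<lambda>t. \<delta> a b (\<tau> * t)) \<tau> (\<delta> a b)))"
proof -
  define m where "m = (a + b) / 2"
  define c where "c = \<bar>b - a\<bar> / 2"
  have c: "0 < c"
    using assms(1) by (simp add: c_def)
  have mc: "m + c = max a b"
    by (auto simp: m_def c_def max_def abs_if field_simps)
  have \<delta>: "\<delta> a b t = m + c * langevin (c * t)" if "t \<noteq> 0" for t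
    using \<delta>_eq_langevin[OF assms(1) that] by (simp add: m_def c_def)
  have mono: "\<delta> a b s < \<delta> a b t" if "0 < s" "s < t" for s t
    using that c by (simp add: \<delta> langevin_strict_mono)
  have \<delta>_gt: "m < \<delta> a b t" if "0 < t" for t
    using that c by (simp add: \<delta> langevin_pos)
  have \<delta>_lt: "\<delta> a b t < m + c" if "0 < t" for t
    using that c by (simp add: \<delta> langevin_less_1)
  have concave: "concave_on {0<..} (\<lambda>t. c * langevin (c * t))"
    using c by (intro concave_on_cmul concave_on_pos_scale concave_on_langevin) auto

  have "concave_on {0<..} (\<lambda>t. m + c * langevin (c * t))"
    by (intro concave_on_add concave) (simp add: concave_on_const)
  then have concave\<delta>: "concave_on {0<..} (\<delta> a b)"
    unfolding concave_on_def by (rule convex_on_congruent) (simp add: \<delta>)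
  have "convex_on {..<0} (\<lambda>t. m + - (c * langevin (c * (- t))))"
    by (intro convex_on_add convex_on_neg_reflect concave) (simp add: convex_on_const)
  then have convex\<delta>: "convex_on {..<0} (\<delta> a b)"
    by (rule convex_on_congruent) (simp add: \<delta> langevin_minus)

  have sharp1: "sharp_upper_on {0<..} (\<lambda>t. \<delta> a b (\<tau> * t)) 1 (\<delta> a b)"
    unfolding sharp_upper_on_def
  proof (intro allI impI ballI)
    fix k t :: real
    assume k: "\<forall>t\<in>{0<..}. \<delta> a b (\<tau> * t) \<le> k * \<delta> a b t" and t: "t \<in> {0<..}"
    have k': "m + c * langevin (c * (\<tau> * s)) \<le> k * (m + c * langevin (c * s))" if "0 < s" for s
      using bspec[OF k, of s] that assms by (simp add: \<delta>)
    \<comment> \<open>Let \<open>s\<close> tend to infinity: both arguments of \<open>langevin\<close> do, where its limit is \<open>1\<close>.\<close>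
    have "m + c * 1 \<le> k * (m + c * 1)"
    proof (rule tendsto_le)
      show "((\<lambda>s. m + c * langevin (c * (\<tau> * s))) \<longlongrightarrow> m + c * 1) at_top"
      proof (intro tendsto_intros filterlim_compose[OF langevin_tendsto_1])
        show "filterlim (\<lambda>s. c * (\<tau> * s)) at_top at_top"
          using c assms by real_asymp
      qed
      show "((\<lambda>s. k * (m + c * langevin (c * s))) \<longlongrightarrow> k * (m + c * 1)) at_top"
      proof (intro tendsto_intros filterlim_compose[OF langevin_tendsto_1])
        show "filterlim (\<lambda>s. c * s) at_top at_top"
          using c by real_asymp
      qed
      show "\<forall>\<^sub>F s in at_top. m + c * langevin (c * (\<tau> * s)) \<le> k * (m + c * langevin (c * s))"
        using eventually_gt_at_top[of 0] by eventually_elim (rule k')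
    qed simp
    then have top: "0 \<le> (k - 1) * (m + c)"
      by (simp add: algebra_simps)
    \<comment> \<open>Let \<open>s\<close> tend to \<open>0\<close> from the right; the limit is the value of the Langevin form at \<open>0\<close>.\<close>
    have "m + c * langevin (c * (\<tau> * 0)) \<le> k * (m + c * langevin (c * 0))"
    proof (rule tendsto_le)
      have isCont: "isCont langevin x" for x
        using continuous_on_langevin by (simp add: continuous_on_eq_continuous_at)
      show "((\<lambda>s. m + c * langevin (c * (\<tau> * s))) \<longlongrightarrow> m + c * langevin (c * (\<tau> * 0))) (at_right 0)"
        by (intro tendsto_intros isCont_tendsto_compose[OF isCont])
      show "((\<lambda>s. k * (m + c * langevin (c * s))) \<longlongrightarrow> k * (m + c * langevin (c * 0))) (at_right 0)"
        by (intro tendsto_intros isCont_tendsto_compose[OF isCont])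
      show "\<forall>\<^sub>F s in at_right 0. m + c * langevin (c * (\<tau> * s)) \<le> k * (m + c * langevin (c * s))"
        using eventually_at_right_less[of 0] by eventually_elim (rule k')
    qed simp
    then have bot: "0 \<le> (k - 1) * m"
      by (simp add: langevin_0 algebra_simps)
    \<comment> \<open>The expression is linear in the value \<open>\<delta> a b t\<close> and nonnegative at both bounds \<open>m\<close> and
      \<open>m + c\<close>; which bound is used depends on the sign of \<open>k - 1\<close>.\<close>
    have "0 \<le> (k - 1) * \<delta> a b t"
    proof (cases "1 \<le> k")
      case True
      have "(k - 1) * m \<le> (k - 1) * \<delta> a b t"
        using True \<delta>_gt[of t] t by (intro mult_left_mono) auto
      with bot show ?thesis by simp
    next
      case False
      have "(k - 1) * (m + c) \<le> (k - 1) * \<delta> a b t"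
        using False \<delta>_lt[of t] t by (intro mult_left_mono_neg) auto
      with top show ?thesis by simp
    qed
    then show "1 * \<delta> a b t \<le> k * \<delta> a b t"
      by (simp add: algebra_simps)
  qed

  have star: "\<sigma> * \<delta> a b t < \<delta> a b (\<sigma> * t)"
    if "0 \<le> a + b" "0 < t" "0 < \<sigma>" "\<sigma> < 1" for \<sigma> t
  proof -
    have "\<sigma> * (c * langevin (c * t)) < c * langevin (c * (\<sigma> * t))"
      using scaled_langevin_less[of "c * t" \<sigma>] that c by (simp add: mult.left_commute)
    moreover have "\<sigma> * m \<le> m"
      using that by (simp add: m_def mult_left_le_one_le)
    ultimately show ?thesis
      using that by (simp add: \<delta> distrib_left)
  qed
  have rstar: "\<delta> a b (\<sigma> * t) < \<sigma> * \<delta> a b t"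
    if "max a b \<le> 0" "0 < t" "0 < \<sigma>" "\<sigma> < 1" for \<sigma> t
  proof -
    have "\<delta> a b (\<sigma> * t) < \<delta> a b t"
      using that by (intro mono) auto
    moreover have "\<delta> a b t < 0"
      using \<delta>_lt[of t] mc that by linarith
    then have "\<delta> a b t \<le> \<sigma> * \<delta> a b t"
      using that by (simp add: mult_le_cancel_right1)
    ultimately show ?thesis by linarith
  qed

  have sharp2: "sharp_lower_on {0<..} (\<lambda>t. \<delta> a b (\<tau> * t)) \<tau> (\<delta> a b)" if "a + b = 0"
    unfolding sharp_lower_on_def
  proof (intro allI impI ballI)
    fix k t :: real
    assume k: "\<forall>t\<in>{0<..}. k * \<delta> a b t \<le> \<delta> a b (\<tau> * t)" and t: "t \<in> {0<..}"
    have m0: "m = 0"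
      using that by (simp add: m_def)
    have k': "k * langevin x \<le> langevin (\<tau> * x)" if "0 < x" for x
      using bspec[OF k, of "x / c"] that c assms by (simp add: \<delta> m0)
    \<comment> \<open>Divide by \<open>x\<close> and let \<open>x\<close> tend to \<open>0\<close>: only the slope \<open>1 / 3\<close> at the origin survives.\<close>
    have "k * (1 / 3) \<le> \<tau> * (1 / 3)"
    proof (rule tendsto_le)
      show "((\<lambda>x. k * (langevin x / x)) \<longlongrightarrow> k * (1 / 3)) (at_right 0)"
        by (intro tendsto_intros langevin_over_id_tendsto)
      have "filterlim (\<lambda>x. \<tau> * x) (at_right 0) (at_right 0)"
        using assms by real_asymp
      then show "((\<lambda>x. \<tau> * (langevin (\<tau> * x) / (\<tau> * x))) \<longlongrightarrow> \<tau> * (1 / 3)) (at_right 0)"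
        by (intro tendsto_intros filterlim_compose[OF langevin_over_id_tendsto])
      show "\<forall>\<^sub>F x in at_right 0. k * (langevin x / x) \<le> \<tau> * (langevin (\<tau> * x) / (\<tau> * x))"
        using eventually_at_right_less[of 0]
      proof eventually_elim
        case (elim x)
        with k'[of x] assms show ?case by (simp add: divide_right_mono)
      qed
    qed simp
    then show "k * \<delta> a b t \<le> \<tau> * \<delta> a b t"
      using \<delta>_gt[of t] t m0 by (simp add: mult_right_mono)
  qed

  show ?thesis
    using mono assms concave\<delta> convex\<delta> sharp1 star rstar sharp2
    by (auto simp: strict_mono_on_def star_shaped_def intro: less_imp_le)
qed

end
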